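(* Consider the fidelity estimation problem with a single observable $O=|\psi\rangle\langle\psi|$ for a pure state $|\psi\rangle\in\mathbb{C}^d$, and unknown state $\rho=\mathbb{I}_d/d$. Let $K$ be the batch size of the median-of-means classical shadows estimator. For $n$ sufficiently large, $\gamma\ge 1/K$, and $d\ge 1000$, there exists an adversary that corrupts an $O(\gamma)$ fraction of the outcome vectors $|v_1\rangle,\ldots,|v_n\rangle$ and causes an error of at least $\Omega(\gamma d)$ for the median-of-means estimator.
   Context: Uniform POVM / classical shadows: each of $n$ copies of $\rho\in\mathbb{C}^{d\times d}$ is measured with the uniform POVM $\{d|v\rangle\langle v|\,\mathrm{d}v\}$ over unit vectors $|v\rangle\in\mathbb{C}^d$ ($\mathrm{d}v$ the unitarily invariant (Haar) probability measure on the complex unit sphere), so the outcome $|v\rangle$ has density $d\langle v|\rho|v\rangle$ with respect to $\mathrm{d}v$; this gives outcomes $|v_1\rangle,\ldots,|v_n\rangle$. Since $\operatorname{Tr}[O\rho]=(d+1)\mathbb{E}[\langle v|O|v\rangle]-\operatorname{Tr}[O]$, the median-of-means estimator with batch size $K$ divides the $n$ outcomes into $n/K$ batches of $K$ outcomes each, computes in each batch the empirical mean of $(d+1)\langle v_j|O|v_j\rangle-\operatorname{Tr}[O]$, and outputs the median of these batch means. The adversary may replace outcome vectors $|v_j\rangle$ by arbitrary unit vectors.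
   Formalization: The formal statement also assumes γ ≤ 1: the estimator always lies in [-1, d], so an error of Ω(γd) is impossible for large γ; n runs over multiples of K, and "n sufficiently large" is read as success with probability tending to 1. *)

theory Defs
  imports "HOL-Probability.Probability"
begin

text \<open>Vectors in C^d are represented as extensional functions nat => complex
  supported on {..<d}; d x d matrices as nat => nat => complex (entries i,j < d).\<close>

type_synonym cvec = "nat \<Rightarrow> complex"
type_synonym cmat = "nat \<Rightarrow> nat \<Rightarrow> complex"

definition sqnorm :: "nat \<Rightarrow> cvec \<Rightarrow> real" where
  "sqnorm d v = (\<Sum>i<d. (cmod (v i))\<^sup>2)"

definition lebesgue_cvec :: "nat \<Rightarrow> cvec measure" where
  "lebesgue_cvec d = PiM {..<d} (\<lambda>_. (lborel :: complex measure))"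

definition borel_cvec :: "nat \<Rightarrow> cvec measure" where
  "borel_cvec d = PiM {..<d} (\<lambda>_. (borel :: complex measure))"

definition unit_ball_c :: "nat \<Rightarrow> cvec set" where
  "unit_ball_c d = {v \<in> {..<d} \<rightarrow>\<^sub>E UNIV. sqnorm d v \<le> 1}"

definition unit_sphere_c :: "nat \<Rightarrow> cvec set" where
  "unit_sphere_c d = {v \<in> {..<d} \<rightarrow>\<^sub>E UNIV. sqnorm d v = 1}"

definition normalize_c :: "nat \<Rightarrow> cvec \<Rightarrow> cvec" where
  "normalize_c d v = restrict (\<lambda>i. v i / complex_of_real (sqrt (sqnorm d v))) {..<d}"

text \<open>The unitarily invariant (Haar) probability measure on the complex unit sphere
  of C^d, realised as the radial projection of the uniform distribution on the
  unit ball (the normalised cone / surface measure).\<close>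
definition uniform_sphere :: "nat \<Rightarrow> cvec measure" where
  "uniform_sphere d =
     distr (uniform_measure (lebesgue_cvec d) (unit_ball_c d))
           (restrict_space (borel_cvec d) (unit_sphere_c d)) (normalize_c d)"

definition qform :: "nat \<Rightarrow> cmat \<Rightarrow> cvec \<Rightarrow> complex" where
  "qform d A v = (\<Sum>i<d. \<Sum>j<d. cnj (v i) * A i j * v j)"

definition mtrace :: "nat \<Rightarrow> cmat \<Rightarrow> complex" where
  "mtrace d A = (\<Sum>i<d. A i i)"

definition mmult :: "nat \<Rightarrow> cmat \<Rightarrow> cmat \<Rightarrow> cmat" where
  "mmult d A B = (\<lambda>i j. \<Sum>k<d. A i k * B k j)"

definition povm_outcome :: "nat \<Rightarrow> cmat \<Rightarrow> cvec measure" where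
  "povm_outcome d \<rho> = density (uniform_sphere d) (\<lambda>v. ennreal (real d * Re (qform d \<rho> v)))"

definition povm_samples :: "nat \<Rightarrow> cmat \<Rightarrow> nat \<Rightarrow> (nat \<Rightarrow> cvec) measure" where
  "povm_samples d \<rho> n = PiM {..<n} (\<lambda>_. povm_outcome d \<rho>)"

definition maximally_mixed :: "nat \<Rightarrow> cmat" where
  "maximally_mixed d = (\<lambda>i j. if i = j then 1 / of_nat d else 0)"

definition projector :: "cvec \<Rightarrow> cmat" where
  "projector \<psi> = (\<lambda>i j. \<psi> i * cnj (\<psi> j))"

text \<open>Single-shot unbiased estimate (d+1)<v|O|v> - Tr O.\<close>
definition shadow_est :: "nat \<Rightarrow> cmat \<Rightarrow> cvec \<Rightarrow> real" where
  "shadow_est d Obs v = real (d + 1) * Re (qform d Obs v) - Re (mtrace d Obs)"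

definition median :: "real list \<Rightarrow> real" where
  "median xs = (let ys = sort xs; m = length xs in
     if odd m then ys ! (m div 2) else (ys ! (m div 2 - 1) + ys ! (m div 2)) / 2)"

definition batch_mean :: "nat \<Rightarrow> cmat \<Rightarrow> nat \<Rightarrow> (nat \<Rightarrow> cvec) \<Rightarrow> nat \<Rightarrow> real" where
  "batch_mean d Obs K v b = (\<Sum>j\<in>{b*K..<b*K+K}. shadow_est d Obs (v j)) / real K"

definition mom_estimate :: "nat \<Rightarrow> cmat \<Rightarrow> nat \<Rightarrow> nat \<Rightarrow> (nat \<Rightarrow> cvec) \<Rightarrow> real" where
  "mom_estimate d Obs K n v = median (map (batch_mean d Obs K v) [0..<n div K])"

end

theory Submission
  imports Defs
begin

text \<open>
  The adversary sees the outcomes. Let \<open>\<Delta> = d - 1 / d\<close> be the distance from the true fidelity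
  \<open>1 / d\<close> to the single-shot estimate \<open>d\<close> of the outcome \<open>\<psi>\<close>. If the median of means is already
  wrong by \<open>\<gamma> \<Delta> / 2\<close>, the adversary does nothing. Otherwise it replaces, in every batch, the
  \<open>m = \<lceil>\<gamma> K\<rceil>\<close> outcomes with the smallest single-shot estimates by \<open>\<psi>\<close>. The removed estimates average
  at most the old batch mean \<open>M\<close>, so the new batch mean is at least \<open>(1 - m / K) M + (m / K) d\<close>. This
  is an increasing affine function of \<open>M\<close>, so the same bound holds for the medians: an old error
  \<open>e > - \<gamma> \<Delta> / 2\<close> becomes at least \<open>(1 - m / K) e + (m / K) \<Delta> \<ge> \<gamma> \<Delta> / 2\<close>. The attack succeeds on
  every sample, so no concentration argument is needed.
\<close>

section \<open>Order statistics and the median\<close>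

lemma list_all2_le_insort:
  fixes x y :: "'a :: linorder"
  assumes "list_all2 (\<le>) xs ys" "x \<le> y" "sorted xs" "sorted ys"
  shows "list_all2 (\<le>) (insort x xs) (insort y ys)"
  using assms
proof (induction arbitrary: x y rule: list_all2_induct)
  case Nil
  then show ?case by simp
next
  case (Cons a as b bs)
  have insort_a: "insort a as = a # as" and insort_b: "insort b bs = b # bs"
    using Cons.prems by (simp_all add: insort_is_Cons)
  have "list_all2 (\<le>) (a # as) (insort y bs)" if "a \<le> y"
    using Cons.IH[OF that] Cons.prems by (simp add: insort_a)
  moreover have "list_all2 (\<le>) (insort x as) (b # bs)" if "x \<le> b"
    using Cons.IH[OF that] Cons.prems by (simp add: insort_b)
  moreover have "list_all2 (\<le>) (insort x as) (insort y bs)"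
    using Cons by simp
  ultimately show ?case
    using Cons.hyps Cons.prems(1) by auto
qed

lemma list_all2_le_sort:
  fixes xs ys :: "'a :: linorder list"
  assumes "list_all2 (\<le>) xs ys"
  shows "list_all2 (\<le>) (sort xs) (sort ys)"
  using assms by (induction rule: list_all2_induct) (simp_all add: list_all2_le_insort)

lemma sort_map_mono:
  fixes f :: "'a :: linorder \<Rightarrow> 'b :: linorder"
  assumes "mono f"
  shows "sort (map f xs) = map f (sort xs)"
proof (rule properties_for_sort)
  show "sorted (map f (sort xs))"
    unfolding sorted_map
    by (rule sorted_wrt_mono_rel[OF _ sorted_sort]) (use assms in \<open>auto dest: monoD\<close>)
qed simp

lemma median_mono:
  assumes "list_all2 (\<le>) xs ys"
  shows "median xs \<le> median ys"
proof (cases "xs = []")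
  case True
  then show ?thesis using assms by simp
next
  case False
  have len: "length ys = length xs"
    using assms by (simp add: list_all2_lengthD)
  have "length xs div 2 < length xs" "length xs div 2 - 1 < length xs"
    using False by (cases xs; simp)+
  then have "sort xs ! (length xs div 2) \<le> sort ys ! (length xs div 2)"
    "sort xs ! (length xs div 2 - 1) \<le> sort ys ! (length xs div 2 - 1)"
    using list_all2_le_sort[OF assms] by (simp_all add: list_all2_nthD)
  then show ?thesis
    by (auto simp: median_def Let_def len intro!: divide_right_mono add_mono)
qed

lemma median_affine:
  assumes "xs \<noteq> []" and "a \<ge> 0"
  shows "median (map (\<lambda>x. a * x + b) xs) = a * median xs + b"
proof -
  have "sort (map (\<lambda>x. a * x + b) xs) = map (\<lambda>x. a * x + b) (sort xs)"
    using assms(2) by (intro sort_map_mono monoI) (simp add: mult_left_mono)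
  moreover have "length xs div 2 < length xs" "length xs div 2 - 1 < length xs"
    using assms(1) by (cases xs; simp)+
  ultimately show ?thesis
    by (simp add: median_def Let_def field_simps)
qed

lemma ex_subset_sum_le_average:
  fixes f :: "'a \<Rightarrow> real"
  assumes "finite A" and "m \<le> card A"
  shows "\<exists>S\<subseteq>A. card S = m \<and> sum f S \<le> real m / real (card A) * sum f A"
  using assms(2)
proof (induction rule: inc_induct)
  case base
  show ?case
  proof (intro exI[of _ A] conjI)
    show "sum f A \<le> real (card A) / real (card A) * sum f A"
      using assms(1) by (cases "A = {}") auto
  qed auto
next
  case (step k)
  then obtain S where S: "S \<subseteq> A" "card S = Suc k"
    "sum f S \<le> real (Suc k) / real (card A) * sum f A"
    by blast
  have "finite S" "S \<noteq> {}"
    using S assms(1) by (auto intro: finite_subset)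
  then obtain x where x: "x \<in> S" "Max (f ` S) = f x"
    by (rule obtains_MAX)
  then have "f y \<le> f x" if "y \<in> S" for y
    using that \<open>finite S\<close> by (metis Max_ge finite_imageI imageI)
  then have "sum f S \<le> real (Suc k) * f x"
    using sum_bounded_above[of S f "f x"] S(2) by simp
  then have "real (Suc k) * sum f (S - {x}) \<le> real k * sum f S"
    using \<open>finite S\<close> x(1) by (simp add: sum_diff1 algebra_simps)
  also have "\<dots> \<le> real k * (real (Suc k) / real (card A) * sum f A)"
    using S(3) by (rule mult_left_mono) simp
  also have "\<dots> = real (Suc k) * (real k / real (card A) * sum f A)"
    by simp
  finally have "sum f (S - {x}) \<le> real k / real (card A) * sum f A"
    by (simp only: mult_le_cancel_left_pos of_nat_0_less_iff zero_less_Suc)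
  moreover have "card (S - {x}) = k"
    using S(2) x(1) by simp
  ultimately show ?case
    using S(1) by (intro exI[of _ "S - {x}"] conjI) auto
qed

section \<open>The outcome distribution\<close>

lemma distr_restrict_space:
  assumes f: "f \<in> M \<rightarrow>\<^sub>M N" and S: "S \<in> sets N"
  shows "distr M (restrict_space N S) f = restrict_space (distr M N f) S"
proof -
  have S_subset: "S \<subseteq> space N"
    using S by (rule sets.sets_into_space)
  then have space: "space (restrict_space N S) = S"
    by (auto simp: space_restrict_space)
  have sets: "sets (restrict_space N S) = (\<inter>) S ` sets N"
    by (simp add: sets_restrict_space)
  have "sigma_sets S ((\<inter>) S ` sets N) = (\<inter>) S ` sets N"
    using sets.sigma_sets_eq[of "restrict_space N S"] unfolding sets space .
  then show ?thesis
    unfolding distr_def[of _ "restrict_space N S"] sets space restrict_space_def[of "distr _ _ _"]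
    using S_subset S by (auto simp: Int_absorb2 emeasure_distr[OF f] intro!: measure_of_eq
        dest: sets.sets_into_space)
qed

lemma (in prob_space) prob_space_distr_restrict_space:
  assumes f: "f \<in> M \<rightarrow>\<^sub>M N" and S: "S \<in> sets N" and AE: "AE x in M. f x \<in> S"
  shows "prob_space (distr M (restrict_space N S) f)"
proof -
  interpret D: prob_space "distr M N f"
    using f by (rule prob_space_distr)
  have "AE y in distr M N f. y \<in> S"
    using S AE by (subst AE_distr_iff[OF f]) auto
  then have "emeasure (distr M N f) S = 1"
    using S by (intro D.emeasure_eq_1_AE) auto
  then show ?thesis
    unfolding distr_restrict_space[OF f S] using S by (intro prob_space_restrict_space) auto
qed

lemma ex_events_prob_tendsto_1_if_eventually_sure:
  assumes "\<And>N. prob_space (P N)"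
    and "\<forall>\<^sub>F N in sequentially. \<forall>x \<in> space (P N). Q N x"
  shows "\<exists>E. (\<forall>N. E N \<in> sets (P N)) \<and> (\<lambda>N. measure (P N) (E N)) \<longlonglongrightarrow> 1 \<and>
    (\<forall>N. \<forall>x \<in> E N. Q N x)"
proof (intro exI conjI allI ballI)
  let ?E = "\<lambda>N. if \<forall>x \<in> space (P N). Q N x then space (P N) else {}"
  show "?E N \<in> sets (P N)" for N by simp
  have "\<forall>\<^sub>F N in sequentially. measure (P N) (?E N) = 1"
    using assms(2) by eventually_elim (simp add: assms(1) prob_space.prob_space)
  then show "(\<lambda>N. measure (P N) (?E N)) \<longlonglongrightarrow> 1"
    by (rule tendsto_eventually)
  show "Q N x" if "x \<in> ?E N" for N x
    using that by (auto split: if_splits)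
qed

lemma sqnorm_nonneg: "sqnorm d v \<ge> 0"
  by (simp add: sqnorm_def sum_nonneg)

lemma sqnorm_measurable [measurable]: "sqnorm d \<in> borel_measurable (borel_cvec d)"
  unfolding sqnorm_def borel_cvec_def by measurable

lemma space_borel_cvec: "space (borel_cvec d) = {..<d} \<rightarrow>\<^sub>E UNIV"
  by (simp add: borel_cvec_def space_PiM)

lemma sets_lebesgue_cvec [measurable_cong]: "sets (lebesgue_cvec d) = sets (borel_cvec d)"
  unfolding lebesgue_cvec_def borel_cvec_def by (intro sets_PiM_cong) auto

lemma unit_ball_c_in_sets [measurable]: "unit_ball_c d \<in> sets (borel_cvec d)"
proof -
  have "unit_ball_c d = {v \<in> space (borel_cvec d). sqnorm d v \<le> 1}"
    by (simp add: unit_ball_c_def space_borel_cvec)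
  then show ?thesis by simp
qed

lemma unit_sphere_c_in_sets [measurable]: "unit_sphere_c d \<in> sets (borel_cvec d)"
proof -
  have "unit_sphere_c d = {v \<in> space (borel_cvec d). sqnorm d v = 1}"
    by (simp add: unit_sphere_c_def space_borel_cvec)
  then show ?thesis by simp
qed

lemma normalize_c_measurable [measurable]: "normalize_c d \<in> borel_cvec d \<rightarrow>\<^sub>M borel_cvec d"
proof -
  have "(\<lambda>v. v i / complex_of_real (sqrt (sqnorm d v))) \<in> borel_measurable (borel_cvec d)"
    if "i < d" for i
  proof -
    have [measurable]: "(\<lambda>v. v i) \<in> borel_measurable (borel_cvec d)"
      unfolding borel_cvec_def using that by (intro measurable_component_singleton) simp
    show ?thesis by measurable
  qed
  then have "(\<lambda>v. \<lambda>i\<in>{..<d}. v i / complex_of_real (sqrt (sqnorm d v)))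
      \<in> borel_cvec d \<rightarrow>\<^sub>M PiM {..<d} (\<lambda>_. borel)"
    by (intro measurable_restrict) simp
  then show ?thesis
    unfolding normalize_c_def[abs_def] borel_cvec_def .
qed

lemma normalize_c_in_unit_sphere_c:
  assumes "sqnorm d v \<noteq> 0"
  shows "normalize_c d v \<in> unit_sphere_c d"
proof -
  have "sqnorm d (normalize_c d v) = (\<Sum>i<d. (cmod (v i))\<^sup>2 / sqnorm d v)"
    unfolding sqnorm_def[of d "normalize_c d v"]
    by (intro sum.cong) (auto simp: normalize_c_def norm_divide power_divide sqnorm_nonneg)
  also have "\<dots> = 1"
    using assms by (simp add: sum_divide_distrib[symmetric] sqnorm_def)
  finally show ?thesis by (simp add: unit_sphere_c_def normalize_c_def)
qed

lemma emeasure_lebesgue_cvec_PiE: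
  assumes "\<And>i. i < d \<Longrightarrow> A i \<in> sets borel"
  shows "emeasure (lebesgue_cvec d) (PiE {..<d} A) = (\<Prod>i<d. emeasure lborel (A i))"
proof -
  interpret product_sigma_finite "\<lambda>_ :: nat. lborel :: complex measure"
    by unfold_locales
  show ?thesis
    unfolding lebesgue_cvec_def using assms by (subst emeasure_PiM) auto
qed

lemma unit_ball_c_subset_polydisc: "unit_ball_c d \<subseteq> ({..<d} \<rightarrow>\<^sub>E cball 0 1)"
proof
  fix v assume v: "v \<in> unit_ball_c d"
  have "cmod (v i) \<le> 1" if "i < d" for i
  proof (rule power2_le_imp_le)
    have "(cmod (v i))\<^sup>2 \<le> sqnorm d v"
      unfolding sqnorm_def using that by (intro member_le_sum) auto
    then show "(cmod (v i))\<^sup>2 \<le> 1\<^sup>2" using v by (simp add: unit_ball_c_def)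
  qed simp
  then show "v \<in> ({..<d} \<rightarrow>\<^sub>E cball 0 1)"
    using v by (auto simp: unit_ball_c_def PiE_iff)
qed

lemma polydisc_subset_unit_ball_c:
  assumes "real d * r\<^sup>2 \<le> 1"
  shows "({..<d} \<rightarrow>\<^sub>E cball 0 r) \<subseteq> unit_ball_c d"
proof
  fix v assume v: "v \<in> ({..<d} \<rightarrow>\<^sub>E cball (0::complex) r)"
  have "sqnorm d v \<le> (\<Sum>i<d. r\<^sup>2)"
    unfolding sqnorm_def using v by (intro sum_mono power_mono) (auto simp: PiE_iff)
  also have "\<dots> \<le> 1" using assms by simp
  finally show "v \<in> unit_ball_c d" using v by (auto simp: unit_ball_c_def PiE_iff)
qed

lemma emeasure_unit_ball_c_finite: "emeasure (lebesgue_cvec d) (unit_ball_c d) < \<infinity>"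
proof -
  have "emeasure (lebesgue_cvec d) (unit_ball_c d)
      \<le> emeasure (lebesgue_cvec d) ({..<d} \<rightarrow>\<^sub>E cball 0 1)"
    using unit_ball_c_subset_polydisc
    by (rule emeasure_mono) (auto simp: lebesgue_cvec_def intro!: sets_PiM_I_finite)
  also have "\<dots> < \<infinity>"
    using emeasure_lborel_cball_finite[of "0::complex" 1]
    by (simp add: emeasure_lebesgue_cvec_PiE power_less_top_ennreal)
  finally show ?thesis .
qed

lemma emeasure_unit_ball_c_pos: "emeasure (lebesgue_cvec d) (unit_ball_c d) > 0"
proof -
  define r where "r = 1 / sqrt (real d + 1)"
  have r: "r > 0" "real d * r\<^sup>2 \<le> 1"
    by (simp_all add: r_def divide_simps)
  have "emeasure lborel (cball (0::complex) r) \<noteq> 0"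
    using content_cball_pos[OF r(1), of "0::complex"] by (auto simp: measure_def)
  then have "emeasure lborel (cball (0::complex) r) ^ d \<noteq> 0"
    by (rule power_not_zero)
  then have "0 < emeasure (lebesgue_cvec d) ({..<d} \<rightarrow>\<^sub>E cball 0 r)"
    unfolding zero_less_iff_neq_zero by (simp add: emeasure_lebesgue_cvec_PiE del: power_eq_0_iff)
  also have "\<dots> \<le> emeasure (lebesgue_cvec d) (unit_ball_c d)"
    using polydisc_subset_unit_ball_c[OF r(2)]
    by (rule emeasure_mono) (simp add: sets_lebesgue_cvec unit_ball_c_in_sets)
  finally show ?thesis .
qed

lemma AE_sqnorm_nonzero:
  assumes "d > 0"
  shows "AE v in lebesgue_cvec d. sqnorm d v \<noteq> 0"
proof (rule AE_I')
  show "{v \<in> space (lebesgue_cvec d). \<not> sqnorm d v \<noteq> 0} \<subseteq> {..<d} \<rightarrow>\<^sub>E {0}"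
    by (auto simp: lebesgue_cvec_def space_PiM sqnorm_def sum_nonneg_eq_0_iff PiE_iff
        extensional_def)
  have "emeasure (lebesgue_cvec d) ({..<d} \<rightarrow>\<^sub>E {0}) = 0"
    using assms by (subst emeasure_lebesgue_cvec_PiE) auto
  then show "({..<d} \<rightarrow>\<^sub>E {0}) \<in> null_sets (lebesgue_cvec d)"
    unfolding lebesgue_cvec_def by (intro null_setsI sets_PiM_I_finite) auto
qed

lemma space_uniform_sphere: "space (uniform_sphere d) = unit_sphere_c d"
  using sets.sets_into_space[OF unit_sphere_c_in_sets[of d]]
  by (auto simp: uniform_sphere_def space_restrict_space)

text \<open>
  Because of \<open>x / 0 = 0\<close>, \<open>normalize_c d\<close> maps the origin to itself, outside the sphere, so it is
  not measurable into the restricted space and \<open>prob_space_distr\<close> does not apply directly.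
\<close>
lemma prob_space_uniform_sphere:
  assumes "d > 0"
  shows "prob_space (uniform_sphere d)"
proof -
  interpret prob_space "uniform_measure (lebesgue_cvec d) (unit_ball_c d)"
    using emeasure_unit_ball_c_finite[of d] emeasure_unit_ball_c_pos[of d]
    by (intro prob_space_uniform_measure) (auto simp: less_top)
  have "AE v in uniform_measure (lebesgue_cvec d) (unit_ball_c d). normalize_c d v \<in> unit_sphere_c d"
    using AE_sqnorm_nonzero[OF assms]
    by (intro AE_uniform_measureI) (auto simp: sets_lebesgue_cvec normalize_c_in_unit_sphere_c)
  then show ?thesis
    unfolding uniform_sphere_def by (intro prob_space_distr_restrict_space) measurable
qed

lemma sum_cnj_mult_self: "(\<Sum>i<d. cnj (v i) * v i) = complex_of_real (sqnorm d v)"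
  by (simp add: sqnorm_def mult.commute[of "cnj _"] flip: complex_norm_square)

lemma qform_maximally_mixed:
  "qform d (maximally_mixed d) v = complex_of_real (sqnorm d v / real d)"
proof -
  have "qform d (maximally_mixed d) v = (\<Sum>i<d. cnj (v i) * v i / of_nat d)"
    unfolding qform_def maximally_mixed_def
    by (intro sum.cong refl) (simp add: if_distrib[of "\<lambda>x. _ * x"] if_distrib[of "\<lambda>x. x * _"]
        cong: if_cong)
  then show ?thesis
    by (simp add: sum_divide_distrib[symmetric] sum_cnj_mult_self)
qed

lemma povm_outcome_maximally_mixed:
  assumes "d > 0"
  shows "povm_outcome d (maximally_mixed d) = uniform_sphere d"
proof -
  have density_eq_1: "ennreal (real d * Re (qform d (maximally_mixed d) v)) = 1"
    if "v \<in> space (uniform_sphere d)" for v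
    using that assms by (simp add: space_uniform_sphere unit_sphere_c_def qform_maximally_mixed)
  then have "(\<lambda>v. ennreal (real d * Re (qform d (maximally_mixed d) v)))
      \<in> borel_measurable (uniform_sphere d)"
    by (subst measurable_cong[OF density_eq_1]) simp_all
  then have "povm_outcome d (maximally_mixed d) = density (uniform_sphere d) (\<lambda>_. 1)"
    unfolding povm_outcome_def by (intro density_cong) (auto simp: density_eq_1)
  then show ?thesis by (simp add: density_1)
qed

lemma prob_space_povm_samples_maximally_mixed:
  assumes "d > 0"
  shows "prob_space (povm_samples d (maximally_mixed d) n)"
  unfolding povm_samples_def povm_outcome_maximally_mixed[OF assms]
  using assms by (intro prob_space_PiM prob_space_uniform_sphere)

lemma space_povm_samples: "space (povm_samples d \<rho> n) = {..<n} \<rightarrow>\<^sub>E unit_sphere_c d"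
  by (simp add: povm_samples_def povm_outcome_def space_PiM space_uniform_sphere)

section \<open>Single-shot estimates\<close>

lemma qform_projector:
  "qform d (projector \<psi>) v = (\<Sum>i<d. cnj (v i) * \<psi> i) * (\<Sum>j<d. cnj (\<psi> j) * v j)"
  unfolding qform_def projector_def sum_product by (simp add: mult_ac)

lemma mtrace_projector: "mtrace d (projector \<psi>) = complex_of_real (sqnorm d \<psi>)"
  by (simp add: mtrace_def projector_def mult.commute flip: sum_cnj_mult_self)

lemma shadow_est_projector_self:
  assumes "\<psi> \<in> unit_sphere_c d"
  shows "shadow_est d (projector \<psi>) \<psi> = real d"
  using assms
  by (simp add: shadow_est_def qform_projector mtrace_projector sum_cnj_mult_self unit_sphere_c_def)

lemma mtrace_mmult_maximally_mixed:
  "mtrace d (mmult d A (maximally_mixed d)) = mtrace d A / of_nat d"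
proof -
  have "mtrace d (mmult d A (maximally_mixed d)) = (\<Sum>i<d. A i i / of_nat d)"
    unfolding mtrace_def mmult_def maximally_mixed_def
    by (intro sum.cong refl) (simp add: if_distrib[of "\<lambda>x. _ * x"] cong: if_cong)
  then show ?thesis
    by (simp add: mtrace_def sum_divide_distrib)
qed

section \<open>Corrupting the batches\<close>

definition batch :: "nat \<Rightarrow> nat \<Rightarrow> nat set" where
  "batch K b = {b * K..<b * K + K}"

lemma finite_batch [simp]: "finite (batch K b)"
  by (simp add: batch_def)

lemma card_batch [simp]: "card (batch K b) = K"
  by (simp add: batch_def)

lemma div_eq_if_mem_batch: "j \<in> batch K b \<Longrightarrow> j div K = b"
  by (intro div_nat_eqI) (auto simp: batch_def mult.commute)

lemma batch_subset: "b < N \<Longrightarrow> batch K b \<subseteq> {..<N * K}"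
  using mult_le_mono1[of "Suc b" N K] by (auto simp: batch_def)

lemma ex_batchwise_subset_sum_le_average:
  fixes f :: "nat \<Rightarrow> real"
  assumes "m \<le> K"
  shows "\<exists>T\<subseteq>{..<N * K}. card T = N * m \<and> (\<forall>b<N. card (T \<inter> batch K b) = m \<and>
    sum f (T \<inter> batch K b) \<le> real m / real K * sum f (batch K b))"
proof -
  have "\<exists>S\<subseteq>batch K b. card S = m \<and> sum f S \<le> real m / real K * sum f (batch K b)" for b
    using ex_subset_sum_le_average[of "batch K b" m f] assms by simp
  then obtain S where S: "\<And>b. S b \<subseteq> batch K b" "\<And>b. card (S b) = m"
    "\<And>b. sum f (S b) \<le> real m / real K * sum f (batch K b)"
    by metis
  define T where "T = (\<Union>b<N. S b)"
  have div_K: "j div K = b" if "j \<in> S b" for j b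
    using that S(1) by (intro div_eq_if_mem_batch) auto
  have "T \<inter> batch K b = S b" if "b < N" for b
    using that S(1)[of b] by (auto simp: T_def dest: div_K div_eq_if_mem_batch)
  moreover have "T \<subseteq> {..<N * K}"
    using S(1) batch_subset unfolding T_def by blast
  moreover have "card T = N * m"
  proof -
    have "card T = (\<Sum>b<N. card (S b))"
      unfolding T_def
      by (intro card_UN_disjoint) (auto intro: finite_subset[OF S(1)] dest: div_K)
    then show ?thesis by (simp add: S(2))
  qed
  ultimately show ?thesis
    using S(2,3) by (intro exI[of _ T]) simp
qed

lemma batch_mean_override_on:
  assumes m: "card (T \<inter> batch K b) = m"
    and low: "(\<Sum>j\<in>T \<inter> batch K b. shadow_est d Obs (v j))
      \<le> real m / real K * (\<Sum>j\<in>batch K b. shadow_est d Obs (v j))"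
  shows "(1 - real m / real K) * batch_mean d Obs K v b + real m / real K * shadow_est d Obs \<phi>
    \<le> batch_mean d Obs K (override_on v (\<lambda>_. \<phi>) T) b"
proof -
  let ?B = "batch K b" and ?X = "\<lambda>j. shadow_est d Obs (v j)"
  have "(\<Sum>j\<in>?B. shadow_est d Obs (override_on v (\<lambda>_. \<phi>) T j))
      = (\<Sum>j\<in>?B \<inter> T. shadow_est d Obs \<phi>) + sum ?X (?B - T)"
    unfolding sum.Int_Diff[OF finite_batch, of _ K b T]
    by (intro arg_cong2[where f = "(+)"] sum.cong) auto
  also have "\<dots> = real m * shadow_est d Obs \<phi> + (sum ?X ?B - sum ?X (T \<inter> ?B))"
    by (simp add: m[symmetric] Int_commute sum.Int_Diff[of ?B ?X T])
  also have "\<dots> \<ge> (1 - real m / real K) * sum ?X ?B + real m * shadow_est d Obs \<phi>"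
    using low by (simp add: algebra_simps)
  finally have "((1 - real m / real K) * sum ?X ?B + real m * shadow_est d Obs \<phi>) / real K
      \<le> (\<Sum>j\<in>?B. shadow_est d Obs (override_on v (\<lambda>_. \<phi>) T j)) / real K"
    by (rule divide_right_mono) simp
  then show ?thesis
    by (simp add: batch_mean_def batch_def add_divide_distrib)
qed

lemma ex_mom_estimate_override_on_ge:
  assumes "m \<le> K" "0 < K" "0 < N"
  shows "\<exists>T\<subseteq>{..<N * K}. card T = N * m \<and>
    (1 - real m / real K) * mom_estimate d Obs K (N * K) v + real m / real K * shadow_est d Obs \<phi>
      \<le> mom_estimate d Obs K (N * K) (override_on v (\<lambda>_. \<phi>) T)"
proof -
  obtain T where T: "T \<subseteq> {..<N * K}" "card T = N * m"
    and T_batch: "\<forall>b<N. card (T \<inter> batch K b) = m \<and> (\<Sum>j\<in>T \<inter> batch K b. shadow_est d Obs (v j))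
        \<le> real m / real K * (\<Sum>j\<in>batch K b. shadow_est d Obs (v j))"
    using ex_batchwise_subset_sum_le_average[OF assms(1), of N "\<lambda>j. shadow_est d Obs (v j)"]
    by auto
  let ?w = "override_on v (\<lambda>_. \<phi>) T"
    and ?h = "\<lambda>x. (1 - real m / real K) * x + real m / real K * shadow_est d Obs \<phi>"
  have batch_means: "?h (batch_mean d Obs K v b) \<le> batch_mean d Obs K ?w b" if "b < N" for b
    using T_batch that by (intro batch_mean_override_on) simp_all
  have "?h (mom_estimate d Obs K (N * K) v)
      = median (map ?h (map (batch_mean d Obs K v) [0..<N]))"
    unfolding mom_estimate_def using assms by (subst median_affine) auto
  also have "\<dots> \<le> mom_estimate d Obs K (N * K) ?w"
    unfolding mom_estimate_def using assms(2) batch_means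
    by (intro median_mono) (simp add: list_all2_conv_all_nth)
  finally show ?thesis
    using T by (intro exI[of _ T] conjI)
qed

lemma ex_fraction_between_double:
  fixes \<gamma> :: real
  assumes "0 < K" "1 / real K \<le> \<gamma>" "\<gamma> \<le> 1"
  shows "\<exists>m\<le>K. \<gamma> \<le> real m / real K \<and> real m / real K \<le> 2 * \<gamma>"
proof -
  define m where "m = nat \<lceil>\<gamma> * real K\<rceil>"
  have "1 \<le> \<gamma> * real K" "\<gamma> * real K \<le> real K"
    using assms by (simp_all add: field_simps)
  then have "m \<le> K" "\<gamma> * real K \<le> real m" "real m \<le> 2 * (\<gamma> * real K)"
    unfolding m_def by linarith+
  then show ?thesis
    using assms(1) by (intro exI[of _ m]) (simp add: field_simps)
qed

lemma half_le_convex_combination: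
  fixes e g \<gamma> \<Delta> :: real
  assumes "0 \<le> \<gamma>" "\<gamma> \<le> g" "g \<le> 1" "0 \<le> \<Delta>" "- (\<gamma> / 2 * \<Delta>) \<le> e"
  shows "\<gamma> / 2 * \<Delta> \<le> (1 - g) * e + g * \<Delta>"
proof -
  have "(1 - g) * (\<gamma> / 2 * \<Delta>) \<le> \<gamma> / 2 * \<Delta>"
    using assms by (intro mult_left_le_one_le) simp_all
  then have "- (\<gamma> / 2 * \<Delta>) \<le> (1 - g) * - (\<gamma> / 2 * \<Delta>)"
    by simp
  also have "\<dots> \<le> (1 - g) * e"
    using assms by (intro mult_left_mono) simp_all
  finally have "\<gamma> / 2 * \<Delta> \<le> (1 - g) * e + \<gamma> * \<Delta>"
    by (simp add: field_simps)
  also have "\<dots> \<le> (1 - g) * e + g * \<Delta>"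
    using assms by (simp add: mult_right_mono)
  finally show ?thesis .
qed

lemma ex_override_on_mom_estimate_error:
  assumes "0 < K" "0 < N" "1 / real K \<le> \<gamma>" "\<gamma> \<le> 1" "\<mu> \<le> shadow_est d Obs \<phi>"
  shows "\<exists>T\<subseteq>{..<N * K}. real (card T) \<le> 2 * \<gamma> * real (N * K) \<and>
    \<gamma> / 2 * (shadow_est d Obs \<phi> - \<mu>)
      \<le> \<bar>mom_estimate d Obs K (N * K) (override_on v (\<lambda>_. \<phi>) T) - \<mu>\<bar>"
proof -
  define \<Delta> where "\<Delta> = shadow_est d Obs \<phi> - \<mu>"
  define e where "e = mom_estimate d Obs K (N * K) v - \<mu>"
  have "0 \<le> \<gamma>"
    using assms(3) by (rule order_trans[rotated]) simp
  show ?thesis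
  proof (cases "\<gamma> / 2 * \<Delta> \<le> \<bar>e\<bar>")
    case True
    then show ?thesis
      using \<open>0 \<le> \<gamma>\<close> by (intro exI[of _ "{}"]) (simp add: \<Delta>_def e_def)
  next
    case False
    obtain m where m: "m \<le> K" "\<gamma> \<le> real m / real K" "real m / real K \<le> 2 * \<gamma>"
      using ex_fraction_between_double[OF assms(1,3,4)] by blast
    define g where "g = real m / real K"
    obtain T where T: "T \<subseteq> {..<N * K}" "card T = N * m"
      "(1 - g) * mom_estimate d Obs K (N * K) v + g * shadow_est d Obs \<phi>
        \<le> mom_estimate d Obs K (N * K) (override_on v (\<lambda>_. \<phi>) T)"
      using ex_mom_estimate_override_on_ge[OF m(1) assms(1,2), of d Obs v \<phi>]
      by (auto simp only: g_def)
    have "\<gamma> / 2 * \<Delta> \<le> (1 - g) * e + g * \<Delta>"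
      using False \<open>0 \<le> \<gamma>\<close> m(1,2) assms(5)
      by (intro half_le_convex_combination) (auto simp: \<Delta>_def g_def divide_simps)
    also have "\<dots> \<le> mom_estimate d Obs K (N * K) (override_on v (\<lambda>_. \<phi>) T) - \<mu>"
      using T(3) by (simp add: e_def \<Delta>_def algebra_simps)
    finally have "\<gamma> / 2 * \<Delta> \<le> \<bar>mom_estimate d Obs K (N * K) (override_on v (\<lambda>_. \<phi>) T) - \<mu>\<bar>"
      by linarith
    moreover have "real (card T) \<le> 2 * \<gamma> * real (N * K)"
      using mult_left_mono[OF m(3), of "real (N * K)"] assms(1) by (simp add: T(2) mult_ac)
    ultimately show ?thesis
      using T(1) by (intro exI[of _ T] conjI) (simp_all only: \<Delta>_def)
  qed
qed

lemma ex_corruption_fidelity_error: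
  assumes "2 \<le> d" "0 < K" "0 < N" "1 / real K \<le> \<gamma>" "\<gamma> \<le> 1"
    and \<psi>: "\<psi> \<in> unit_sphere_c d" and v: "\<forall>j < N * K. v j \<in> unit_sphere_c d"
  shows "\<exists>w. (\<forall>j < N * K. w j \<in> unit_sphere_c d) \<and>
    real (card {j. j < N * K \<and> w j \<noteq> v j}) \<le> 2 * \<gamma> * real (N * K) \<and>
    \<bar>mom_estimate d (projector \<psi>) K (N * K) w
       - Re (mtrace d (mmult d (projector \<psi>) (maximally_mixed d)))\<bar>
      \<ge> 1 / 4 * \<gamma> * real d"
proof -
  let ?\<mu> = "Re (mtrace d (mmult d (projector \<psi>) (maximally_mixed d)))"
  have "?\<mu> = 1 / real d"
    using \<psi> by (simp add: mtrace_mmult_maximally_mixed mtrace_projector unit_sphere_c_def)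
  also have "\<dots> \<le> 1 / 2"
    using assms(1) by simp
  finally have gap: "real d / 2 \<le> real d - ?\<mu>"
    using assms(1) by simp
  obtain T where T: "T \<subseteq> {..<N * K}" "real (card T) \<le> 2 * \<gamma> * real (N * K)"
    "\<gamma> / 2 * (real d - ?\<mu>)
      \<le> \<bar>mom_estimate d (projector \<psi>) K (N * K) (override_on v (\<lambda>_. \<psi>) T) - ?\<mu>\<bar>"
    using ex_override_on_mom_estimate_error[OF assms(2-5), of ?\<mu> d "projector \<psi>" \<psi> v] gap
    by (auto simp: shadow_est_projector_self[OF \<psi>])
  let ?w = "override_on v (\<lambda>_. \<psi>) T"
  have "card {j. j < N * K \<and> ?w j \<noteq> v j} \<le> card T"
    using T(1) by (intro card_mono) (auto simp: override_on_def intro: finite_subset)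
  moreover have "\<gamma> / 2 * (real d / 2) \<le> \<gamma> / 2 * (real d - ?\<mu>)"
    using gap order_trans[OF _ assms(4), of 0] by (intro mult_left_mono) auto
  moreover have "\<forall>j < N * K. ?w j \<in> unit_sphere_c d"
    using \<psi> v by (simp add: override_on_def)
  ultimately show ?thesis
    using T(2,3) by (intro exI[of _ ?w]) auto
qed

theorem theorem4:
  "\<exists>c > 0. \<exists>C > 0. \<forall>d K \<gamma> \<psi>.
     d \<ge> 1000 \<and> K \<ge> 1 \<and> 1 / real K \<le> \<gamma> \<and> \<gamma> \<le> 1 \<and> \<psi> \<in> unit_sphere_c d \<longrightarrow>
     (\<exists>E :: nat \<Rightarrow> (nat \<Rightarrow> cvec) set.
        (\<forall>N. E N \<in> sets (povm_samples d (maximally_mixed d) (N * K))) \<and>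
        (\<lambda>N. measure (povm_samples d (maximally_mixed d) (N * K)) (E N)) \<longlonglongrightarrow> 1 \<and>
        (\<forall>N. \<forall>v \<in> E N. \<exists>w :: nat \<Rightarrow> cvec.
            (\<forall>j < N * K. w j \<in> unit_sphere_c d) \<and>
            real (card {j. j < N * K \<and> w j \<noteq> v j}) \<le> C * \<gamma> * real (N * K) \<and>
            \<bar>mom_estimate d (projector \<psi>) K (N * K) w
               - Re (mtrace d (mmult d (projector \<psi>) (maximally_mixed d)))\<bar>
              \<ge> c * \<gamma> * real d))"
proof (rule exI[of _ "1 / 4"], intro conjI exI[of _ "2 :: real"] allI impI
    ex_events_prob_tendsto_1_if_eventually_sure; (elim conjE)?)
  fix d K N :: nat and \<gamma> :: real and \<psi> :: cvec
  assume d: "d \<ge> 1000"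
  show "prob_space (povm_samples d (maximally_mixed d) (N * K))"
    using d by (intro prob_space_povm_samples_maximally_mixed) simp
next
  fix d K :: nat and \<gamma> :: real and \<psi> :: cvec
  assume params: "d \<ge> 1000" "K \<ge> 1" "1 / real K \<le> \<gamma>" "\<gamma> \<le> 1" "\<psi> \<in> unit_sphere_c d"
  \<comment> \<open>For \<open>N = 0\<close> the estimate is the median of the empty list, a junk value.\<close>
  show "\<forall>\<^sub>F N in sequentially. \<forall>v \<in> space (povm_samples d (maximally_mixed d) (N * K)).
      \<exists>w. (\<forall>j < N * K. w j \<in> unit_sphere_c d) \<and>
        real (card {j. j < N * K \<and> w j \<noteq> v j}) \<le> 2 * \<gamma> * real (N * K) \<and>
        \<bar>mom_estimate d (projector \<psi>) K (N * K) w
           - Re (mtrace d (mmult d (projector \<psi>) (maximally_mixed d)))\<bar> \<ge> 1 / 4 * \<gamma> * real d"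
    using eventually_gt_at_top[of 0]
  proof eventually_elim
    case (elim N)
    then show ?case
      using params
      by (intro ballI ex_corruption_fidelity_error) (auto simp: space_povm_samples PiE_iff)
  qed
qed simp_all

end
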